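(* For any graph $G$ without isolated vertices, $\mathrm{bcw}_1(G)\le (\Delta(G)+1)\,\mathcal H(G)$.
   Context: All graphs are finite, simple and undirected; $\Delta(G)$ is the maximum degree. Hunters and Rabbit game on $G$: the rabbit occupies an initially unknown vertex. In each round the hunters shoot a set of at most $k$ vertices; if the rabbit is on one of them it is caught, otherwise the rabbit must move to an adjacent vertex. The hunters cannot see the rabbit. The hunting number $\mathcal H(G)$ is the minimum $k$ such that some finite sequence of shot sets of size at most $k$ catches the rabbit regardless of its initial position and moves. For radius-$1$ blind cop-width: a blind strategy is a sequence $C_1,\dots,C_m\subseteq V(G)$ using $\max_i|C_i|$ cops, with $A_1=V(G)\setminus C_1$ and $A_{i+1}$ the set of $u\in V(G)\setminus C_{i+1}$ reachable from some vertex of $A_i$ by a path of length at most $1$ (length $0$ allowed) in $G\setminus(C_i\cap C_{i+1})$; it is winning if $A_m=\emptyset$. $\mathrm{bcw}_1(G)$ is the minimum number of cops of a winning strategy. *)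

theory Defs
  imports "Graph_Theory.Graph_Theory"
begin

text \<open>
  Finite simple undirected graphs are the locale \<^locale>\<open>graph\<close>: every edge is a pair of opposite
  arcs, there are no loops and no parallel arcs, so the degree of a vertex is its out-degree.
\<close>

text \<open>The inserted 0 only matters for the null graph.\<close>
definition max_degree :: "('a, 'b) pre_digraph \<Rightarrow> nat" where
  "max_degree G = Max (insert 0 (out_degree G ` verts G))"

definition no_isolated_verts :: "('a, 'b) pre_digraph \<Rightarrow> bool" where
  "no_isolated_verts G \<longleftrightarrow> (\<forall>v \<in> verts G. \<exists>w \<in> verts G. v \<rightarrow>\<^bsub>G\<^esub> w)"


section \<open>Hunters and Rabbit\<close>

text \<open>
  \<open>p ! i\<close> is the position of the rabbit when the set \<open>Ss ! i\<close> is shot. The rabbit moves in every round,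
  so its trajectories over \<open>length Ss\<close> rounds are the walks on that many vertices. A rabbit on an
  isolated vertex has no legal move; such graphs are not covered by this model. The empty sequence
  has to be excluded explicitly, since \<^const>\<open>vwalk\<close> admits no empty walk.
\<close>
definition winning_shots :: "('a, 'b) pre_digraph \<Rightarrow> 'a set list \<Rightarrow> bool" where
  "winning_shots G Ss \<longleftrightarrow>
     Ss \<noteq> [] \<and> (\<forall>S \<in> set Ss. S \<subseteq> verts G) \<and>
     (\<forall>p. vwalk p G \<and> length p = length Ss \<longrightarrow> (\<exists>i < length Ss. p ! i \<in> Ss ! i))"

definition hunting_number :: "('a, 'b) pre_digraph \<Rightarrow> nat" where
  "hunting_number G = (LEAST k. \<exists>Ss. winning_shots G Ss \<and> (\<forall>S \<in> set Ss. card S \<le> k))"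


section \<open>Blind cop-width\<close>

text \<open>
  With \<open>Cs = [C\<^sub>1, \<dots>, C\<^sub>m]\<close>, \<open>blind_area G r Cs i\<close> is the set \<open>A\<^bsub>i+1\<^esub>\<close> of possible robber positions for a robber of
  speed \<open>r\<close>; it is meaningful for \<open>i < m\<close>.
\<close>
primrec blind_area :: "('a, 'b) pre_digraph \<Rightarrow> nat \<Rightarrow> 'a set list \<Rightarrow> nat \<Rightarrow> 'a set" where
  "blind_area G r Cs 0 = verts G - Cs ! 0"
| "blind_area G r Cs (Suc i) =
     {u \<in> verts G - Cs ! Suc i.
        \<exists>v \<in> blind_area G r Cs i. \<exists>p.
          vpath p (G \<restriction> (verts G - (Cs ! i \<inter> Cs ! Suc i))) \<and>
          hd p = v \<and> last p = u \<and> vwalk_length p \<le> r}"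

definition winning_blind :: "('a, 'b) pre_digraph \<Rightarrow> nat \<Rightarrow> 'a set list \<Rightarrow> bool" where
  "winning_blind G r Cs \<longleftrightarrow>
     Cs \<noteq> [] \<and> (\<forall>C \<in> set Cs. C \<subseteq> verts G) \<and> blind_area G r Cs (length Cs - 1) = {}"

definition num_cops :: "'a set list \<Rightarrow> nat" where
  "num_cops Cs = Max (card ` set Cs)"

definition blind_cop_width :: "nat \<Rightarrow> ('a, 'b) pre_digraph \<Rightarrow> nat" where
  "blind_cop_width r G = (LEAST k. \<exists>Cs. winning_blind G r Cs \<and> num_cops Cs = k)"


text \<open>Both minima range over nonempty sets.\<close>

lemma winning_shots_verts: "winning_shots G [verts G]"
  by (auto simp: winning_shots_def vwalk_def length_Suc_conv)

lemma winning_blind_verts: "winning_blind G r [verts G]"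
  by (simp add: winning_blind_def)

end

theory Submission
  imports Defs
begin

text \<open>
  Let the cops occupy the closed neighbourhoods of the shot sets. For every trajectory of the
  robber there is a trajectory of the rabbit that never leaves the closed neighbourhood of the
  robber: if the rabbit is beside the robber, it steps to the robber's old position; if it is on
  the robber, it copies a proper move, and steps to any neighbour when the robber stays. A robber
  avoiding all closed neighbourhoods of the shot sets would thus give a rabbit avoiding all shots.
\<close>

definition closed_nbhd :: "('a, 'b) pre_digraph \<Rightarrow> 'a set \<Rightarrow> 'a set" where
  "closed_nbhd G S = (\<Union>v\<in>S. insert v {w. v \<rightarrow>\<^bsub>G\<^esub> w})"

lemma (in wf_digraph) closed_nbhd_subset_verts:
  assumes "S \<subseteq> verts G"
  shows "closed_nbhd G S \<subseteq> verts G"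
  using assms by (auto simp: closed_nbhd_def)

text \<open>The heads of the arcs leaving \<open>v\<close> are exactly its successors, and taking
  images cannot increase cardinality.\<close>

lemma (in fin_digraph) card_successors_le_out_degree:
  "card {w. v \<rightarrow> w} \<le> out_degree G v"
proof -
  have "{w. v \<rightarrow> w} = head G ` out_arcs G v"
    by (auto simp: arcs_ends_def arc_to_ends_def)
  then show ?thesis
    unfolding out_degree_def by (simp add: card_image_le finite_out_arcs)
qed

text \<open>Union bound: each \<open>v\<close> contributes itself and its successors. This is the
  source of the degree factor in the theorem.\<close>

lemma (in fin_digraph) card_closed_nbhd_le:
  assumes "S \<subseteq> verts G"
  shows "card (closed_nbhd G S) \<le> (max_degree G + 1) * card S"
proof -
  have fin: "finite S" using assms finite_verts finite_subset by blast
  have bound: "card (insert v {w. v \<rightarrow> w}) \<le> max_degree G + 1" if "v \<in> S" for v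
  proof -
    have "out_degree G v \<le> max_degree G"
      using that assms unfolding max_degree_def by (intro Max_ge) auto
    moreover have "card (insert v {w. v \<rightarrow> w}) \<le> Suc (card {w. v \<rightarrow> w})"
      by (rule card_insert_le_m1) simp_all
    ultimately show ?thesis
      using card_successors_le_out_degree[of v] by simp
  qed
  have "card (closed_nbhd G S) \<le> (\<Sum>v\<in>S. card (insert v {w. v \<rightarrow> w}))"
    unfolding closed_nbhd_def by (rule card_UN_le[OF fin])
  also have "\<dots> \<le> (\<Sum>v\<in>S. max_degree G + 1)"
    by (rule sum_mono) (rule bound)
  finally show ?thesis by (simp add: algebra_simps)
qed

lemma vwalk_snoc:
  assumes "vwalk p G" "last p \<rightarrow>\<^bsub>G\<^esub> x" "x \<in> verts G"
  shows "vwalk (p @ [x]) G"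
  using assms by (auto simp: vwalk_def set_vwalk_arcs_snoc)

text \<open>Reduces a robber move at speed 1 to staying put or crossing one edge of
  \<open>G\<close>, the form in which the rabbit can follow it.\<close>

lemma vpath_length_le_1D:
  assumes "vpath p (G \<restriction> X)" "vwalk_length p \<le> 1"
  shows "hd p = last p \<or> hd p \<rightarrow>\<^bsub>G\<^esub> last p"
proof -
  have p: "vwalk p (G \<restriction> X)" using assms(1) by (simp add: vpath_def)
  \<comment> \<open>A \<open>vwalk\<close> is nonempty, so length at most 1 leaves one or two
    vertices.\<close>
  consider v where "p = [v]" | v w where "p = [v, w]"
    using p assms(2) by (cases p; cases "tl p") (auto simp: vwalk_def)
  then show ?thesis
    using p by cases (auto simp: vwalk_def dest: dominates_induce_subgraphD)
qed

text \<open>Induction on the round. The last disjunct, rabbit on or beside the robber, is the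
  invariant: a shot vertex equal or adjacent to \<open>u\<close> would put \<open>u\<close> into the
  cop set, so a rabbit that close to an uncaught robber is not hit.\<close>

lemma (in sym_digraph) blind_area_shadowed_by_rabbit:
  assumes "no_isolated_verts G" and "i < length Ss"
    and "u \<in> blind_area G 1 (map (closed_nbhd G) Ss) i"
  shows "\<exists>p. vwalk p G \<and> length p = Suc i \<and> (\<forall>j \<le> i. p ! j \<notin> Ss ! j) \<and>
           (last p = u \<or> last p \<rightarrow> u)"
  using assms(2,3)
proof (induction i arbitrary: u)
  case 0
  then have "u \<in> verts G" "u \<notin> Ss ! 0"
    by (auto simp: closed_nbhd_def)
  then show ?case
    \<comment> \<open>The rabbit starts on the robber's own vertex.\<close>
    by (intro exI[of _ "[u]"]) (auto simp: vwalk_def)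
next
  case (Suc i)
  let ?Cs = "map (closed_nbhd G) Ss"
  from Suc.prems(2) obtain v q where
    u: "u \<in> verts G" "u \<notin> ?Cs ! Suc i" and v: "v \<in> blind_area G 1 ?Cs i"
    and q: "vpath q (G \<restriction> (verts G - (?Cs ! i \<inter> ?Cs ! Suc i)))"
      "hd q = v" "last q = u" "vwalk_length q \<le> 1"
    by auto
  have step: "v = u \<or> v \<rightarrow> u"
    using vpath_length_le_1D[OF q(1,4)] q(2,3) by simp
  have "i < length Ss" using Suc.prems(1) by simp
  from Suc.IH[OF this v] obtain p where
    p: "vwalk p G" "length p = Suc i" "\<forall>j \<le> i. p ! j \<notin> Ss ! j"
    and near: "last p = v \<or> last p \<rightarrow> v" by blast
  obtain x where x: "last p \<rightarrow> x" "x = u \<or> x \<rightarrow> u"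
  proof (cases "last p \<rightarrow> v")
    case True
    then show ?thesis using step that by blast
  next
    case False
    then have lp: "last p = v" using near by blast
    show ?thesis
    proof (cases "v \<rightarrow> u")
      case True
      then show ?thesis using lp that by blast
    next
      case False
      then have "v = u" using step by blast
      \<comment> \<open>The robber stays under the rabbit, which still has to move: \<open>w\<close>
        exists because \<open>u\<close> is not isolated, and by symmetry \<open>w\<close> is beside
        \<open>u\<close>.\<close>
      moreover obtain w where "u \<rightarrow> w"
        using assms(1) u(1) unfolding no_isolated_verts_def by blast
      ultimately show ?thesis using lp that graph_symmetric by blast
    qed
  qed
  have "x \<notin> Ss ! Suc i"
    using u(2) x(2) Suc.prems(1) by (auto simp: closed_nbhd_def)
  then have "\<forall>j \<le> Suc i. (p @ [x]) ! j \<notin> Ss ! j"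
    using p(2,3) by (auto simp: nth_append le_Suc_eq)
  moreover have "vwalk (p @ [x]) G"
    using p(1) x(1) adj_in_verts(2) by (blast intro: vwalk_snoc)
  ultimately show ?case
    using p(2) x(2) by (intro exI[of _ "p @ [x]"]) simp
qed

text \<open>A robber surviving the last round would be shadowed by a rabbit that escapes every
  shot.\<close>

lemma (in sym_digraph) winning_blind_closed_nbhd:
  assumes "no_isolated_verts G" and "winning_shots G Ss"
  shows "winning_blind G 1 (map (closed_nbhd G) Ss)"
proof -
  let ?m = "length Ss - 1"
  have ne: "Ss \<noteq> []" and sub: "\<forall>S \<in> set Ss. S \<subseteq> verts G"
    and hit: "\<And>p. vwalk p G \<Longrightarrow> length p = length Ss \<Longrightarrow> \<exists>i < length Ss. p ! i \<in> Ss ! i"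
    using assms(2) unfolding winning_shots_def by blast+
  \<comment> \<open>Areas are indexed from 0, so the rabbit walk belonging to area \<open>?m\<close>
    has one vertex per shot set.\<close>
  have m: "?m < length Ss" "Suc ?m = length Ss" using ne by simp_all
  have "blind_area G 1 (map (closed_nbhd G) Ss) ?m = {}"
  proof (rule ccontr)
    assume "\<not> ?thesis"
    then obtain u where "u \<in> blind_area G 1 (map (closed_nbhd G) Ss) ?m" by blast
    from blind_area_shadowed_by_rabbit[OF assms(1) m(1) this] obtain p where
      "vwalk p G" "length p = length Ss" "\<forall>j \<le> ?m. p ! j \<notin> Ss ! j"
      using m(2) by metis
    with hit m(2) show False by (metis less_Suc_eq_le)
  qed
  with ne sub show ?thesis
    unfolding winning_blind_def using closed_nbhd_subset_verts by force
qed

text \<open>The \<open>LEAST\<close> is attained, since shooting all vertices at once wins.\<close>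

lemma hunting_number_witness:
  obtains Ss where "winning_shots G Ss" "\<forall>S \<in> set Ss. card S \<le> hunting_number G"
proof -
  have "\<exists>k Ss. winning_shots G Ss \<and> (\<forall>S \<in> set Ss. card S \<le> k)"
    using winning_shots_verts[of G] by (intro exI[of _ "card (verts G)"] exI[of _ "[verts G]"]) simp
  then have "\<exists>Ss. winning_shots G Ss \<and> (\<forall>S \<in> set Ss. card S \<le> hunting_number G)"
    unfolding hunting_number_def by (rule LeastI_ex)
  then show thesis using that by blast
qed

theorem theorem7p9:
  fixes G :: "('a, 'b) pre_digraph"
  assumes "graph G"
    and "no_isolated_verts G"
  shows "blind_cop_width 1 G \<le> (max_degree G + 1) * hunting_number G"
proof -
  interpret graph G by fact
  obtain Ss where Ss: "winning_shots G Ss" "\<forall>S \<in> set Ss. card S \<le> hunting_number G"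
    by (rule hunting_number_witness)
  let ?Cs = "map (closed_nbhd G) Ss"
  have win: "winning_blind G 1 ?Cs"
    by (rule winning_blind_closed_nbhd[OF assms(2) Ss(1)])
  have "card C \<le> (max_degree G + 1) * hunting_number G" if C: "C \<in> set ?Cs" for C
  proof -
    obtain S where S: "S \<in> set Ss" "C = closed_nbhd G S" using C by auto
    then have "card C \<le> (max_degree G + 1) * card S"
      using Ss(1) card_closed_nbhd_le unfolding winning_shots_def by blast
    also have "\<dots> \<le> (max_degree G + 1) * hunting_number G"
      using Ss(2) S(1) by (intro mult_left_mono) auto
    finally show ?thesis .
  qed
  \<comment> \<open>Nonemptiness lets \<open>Max\<close> in \<open>num_cops\<close> be bounded
    elementwise.\<close>
  moreover have "Ss \<noteq> []" using Ss(1) by (simp add: winning_shots_def)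
  ultimately have "num_cops ?Cs \<le> (max_degree G + 1) * hunting_number G"
    unfolding num_cops_def by (subst Max_le_iff) auto
  moreover have "blind_cop_width 1 G \<le> num_cops ?Cs"
    unfolding blind_cop_width_def using win by (intro Least_le) blast
  ultimately show ?thesis by (rule order_trans[rotated])
qed

end
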